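(* Let $G=(N,E,w)$ be a weighted graph. If for all $\emptyset\neq S\subseteq N$ the $\tilde{\mathcal{P}}_{\min}$-restricted game of the unanimity game $(N,u_S)$ is convex, then the Reinforced Adjacent Cycles condition is satisfied by $G$.
   Context: $G=(N,E,w)$ is a finite simple undirected graph with vertex set $N$, edge set $E$ and weight function $w:E\to\mathbb{R}$. A game is a pair $(N,v)$ with $v:2^N\to\mathbb{R}$, $v(\emptyset)=0$. It is convex if $v(A\cup B)+v(A\cap B)\ge v(A)+v(B)$ for all $A,B\subseteq N$. The unanimity game is $u_S(A)=1$ if $A\supseteq S$ and $0$ otherwise. For $A\subseteq N$, $E(A)$ is the set of edges with both ends in $A$, $G_A=(A,E(A))$, and $\Sigma(A)$ is the set of minimum weight edges in $E(A)$ (empty if $E(A)=\emptyset$). $\mathcal{P}_{\min}(A)$ is the partition of $A$ into the connected components of $(A,E(A)\setminus\Sigma(A))$. If $A_1,\dots,A_p$ are the connected components of $G_A$, then $\tilde{\mathcal{P}}_{\min}(A)$ is the partition of $A$ whose blocks are all the blocks of $\mathcal{P}_{\min}(A_1),\dots,\mathcal{P}_{\min}(A_p)$. The $\tilde{\mathcal{P}}_{\min}$-restricted game of $(N,v)$ is the game $A\mapsto\sum_{F\in\tilde{\mathcal{P}}_{\min}(A)}v(F)$. Cycles have distinct vertices; a cycle is written $C=\{1,e_1,2,e_2,\dots,m,e_m,1\}$ with $e_k=\{k,k+1\}$ for $k<m$ and $e_m=\{m,1\}$; $E(C)=\{e_1,\dots,e_m\}$, $V(C)$ is its vertex set, and $\hat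 E(C)$ is $E(C)$ together with all chords of $C$ in $G$. An edge $e\in\hat E(C)$ is a maximum weight edge of $C$ if $w(e)=\max_{f\in\hat E(C)}w(f)$, otherwise a non-maximum weight edge of $C$. Two (distinct) cycles are adjacent if they share at least one edge. Two vertices or vertex sets are linked by an edge if some edge of $G$ has one end in the first and the other in the second. **Reinforced Adjacent Cycles condition.** For all pairs $\{C,C'\}$ of adjacent cycles in $G$ satisfying one of the following, there exists an edge linking $V(C)\setminus V(C')$ to $V(C')\setminus V(C)$: (1) $|E(C)|=|E(C')|=4$ and $C$, $C'$ have two common non-maximum weight edges; (2) both (a) $|E(C)|=|E(C')|=5$, $|E(C)\cap E(C')|=3$, and $C$ and $C'$ have only one non-maximum weight edge, which is common to $C$ and $C'$; and (b) for a labelling $C=\{1,e_1,2,e_2,3,e_3,4,e_4,5,e_5,1\}$ we have $C'=\{1,e_1,2,e_2,3,e_3',4',e_4',5,e_5,1\}$ with $4'\ne4$, vertices $4$ and $4'$ are neither both linked to $1$ nor both linked to $2$ by edges, and $e_1$ is the unique non-maximum weight edge common to $C$ and $C'$. *)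

theory Defs
  imports Complex_Main
begin

definition simple_graph :: "'a set \<Rightarrow> 'a set set \<Rightarrow> bool" where
  "simple_graph N E \<longleftrightarrow> finite N \<and> (\<forall>e\<in>E. e \<subseteq> N \<and> card e = 2)"


subsection \<open>Games\<close>

definition convex_game :: "'a set \<Rightarrow> ('a set \<Rightarrow> real) \<Rightarrow> bool" where
  "convex_game N v \<longleftrightarrow> v {} = 0 \<and>
     (\<forall>A B. A \<subseteq> N \<longrightarrow> B \<subseteq> N \<longrightarrow> v (A \<union> B) + v (A \<inter> B) \<ge> v A + v B)"

definition unanimity_game :: "'a set \<Rightarrow> 'a set \<Rightarrow> real" where
  "unanimity_game S A = (if S \<subseteq> A then 1 else 0)"


subsection \<open>Minimum partitions and the restricted game\<close>

definition edges_in :: "'a set set \<Rightarrow> 'a set \<Rightarrow> 'a set set" where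
  "edges_in E A = {e \<in> E. e \<subseteq> A}"

text \<open>Only used with edge sets \<open>F\<close> whose members are contained in \<open>A\<close>, so paths stay inside \<open>A\<close>.\<close>

definition components :: "'a set \<Rightarrow> 'a set set \<Rightarrow> 'a set set" where
  "components A F = A // {(x, y). x \<in> A \<and> y \<in> A \<and> (x, y) \<in> {(a, b). {a, b} \<in> F}\<^sup>*}"

definition min_edges :: "'a set set \<Rightarrow> ('a set \<Rightarrow> real) \<Rightarrow> 'a set \<Rightarrow> 'a set set" where
  "min_edges E w A = {e \<in> edges_in E A. \<forall>f \<in> edges_in E A. w e \<le> w f}"

definition P_min :: "'a set set \<Rightarrow> ('a set \<Rightarrow> real) \<Rightarrow> 'a set \<Rightarrow> 'a set set" where
  "P_min E w A = components A (edges_in E A - min_edges E w A)"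

definition P_min_tilde :: "'a set set \<Rightarrow> ('a set \<Rightarrow> real) \<Rightarrow> 'a set \<Rightarrow> 'a set set" where
  "P_min_tilde E w A = (\<Union>K \<in> components A (edges_in E A). P_min E w K)"

definition restricted_game ::
  "'a set set \<Rightarrow> ('a set \<Rightarrow> real) \<Rightarrow> ('a set \<Rightarrow> real) \<Rightarrow> 'a set \<Rightarrow> real" where
  "restricted_game E w v A = (\<Sum>F \<in> P_min_tilde E w A. v F)"


subsection \<open>Cycles\<close>

text \<open>
  A list of distinct vertices is a labelling of a cycle. The same cycle has several labellings
  (rotations and reversals); they are identified by their common edge set, so two cycles are
  distinct iff their edge sets differ.
\<close>

definition cycle_edges :: "'a list \<Rightarrow> 'a set set" where
  "cycle_edges C = {{C ! i, C ! (Suc i mod length C)} | i. i < length C}"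

definition is_cycle :: "'a set set \<Rightarrow> 'a list \<Rightarrow> bool" where
  "is_cycle E C \<longleftrightarrow> length C \<ge> 3 \<and> distinct C \<and> cycle_edges C \<subseteq> E"

definition adjacent_cycles :: "'a list \<Rightarrow> 'a list \<Rightarrow> bool" where
  "adjacent_cycles C C' \<longleftrightarrow>
     cycle_edges C \<noteq> cycle_edges C' \<and> cycle_edges C \<inter> cycle_edges C' \<noteq> {}"

definition chords :: "'a set set \<Rightarrow> 'a list \<Rightarrow> 'a set set" where
  "chords E C = {e \<in> E. e \<subseteq> set C \<and> e \<notin> cycle_edges C}"

definition edges_chords :: "'a set set \<Rightarrow> 'a list \<Rightarrow> 'a set set" where
  "edges_chords E C = cycle_edges C \<union> chords E C"

definition max_weight_edges :: "'a set set \<Rightarrow> ('a set \<Rightarrow> real) \<Rightarrow> 'a list \<Rightarrow> 'a set set" where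
  "max_weight_edges E w C = {e \<in> edges_chords E C. w e = Max (w ` edges_chords E C)}"

definition nonmax_weight_edges :: "'a set set \<Rightarrow> ('a set \<Rightarrow> real) \<Rightarrow> 'a list \<Rightarrow> 'a set set" where
  "nonmax_weight_edges E w C = edges_chords E C - max_weight_edges E w C"

text \<open>An edge is common to two cycles if it lies on both of them; a shared chord does not count.\<close>

definition common_nonmax_edges ::
  "'a set set \<Rightarrow> ('a set \<Rightarrow> real) \<Rightarrow> 'a list \<Rightarrow> 'a list \<Rightarrow> 'a set set" where
  "common_nonmax_edges E w C C' =
     {e \<in> cycle_edges C \<inter> cycle_edges C'.
        e \<in> nonmax_weight_edges E w C \<and> e \<in> nonmax_weight_edges E w C'}"

definition linked :: "'a set set \<Rightarrow> 'a set \<Rightarrow> 'a set \<Rightarrow> bool" where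
  "linked E A B \<longleftrightarrow> (\<exists>x\<in>A. \<exists>y\<in>B. {x, y} \<in> E)"


subsection \<open>The Reinforced Adjacent Cycles condition\<close>

definition RAC_case1 ::
  "'a set set \<Rightarrow> ('a set \<Rightarrow> real) \<Rightarrow> 'a list \<Rightarrow> 'a list \<Rightarrow> bool" where
  "RAC_case1 E w C C' \<longleftrightarrow>
     card (cycle_edges C) = 4 \<and> card (cycle_edges C') = 4 \<and>
     card (common_nonmax_edges E w C C') = 2"

definition RAC_case2a ::
  "'a set set \<Rightarrow> ('a set \<Rightarrow> real) \<Rightarrow> 'a list \<Rightarrow> 'a list \<Rightarrow> bool" where
  "RAC_case2a E w C C' \<longleftrightarrow>
     card (cycle_edges C) = 5 \<and> card (cycle_edges C') = 5 \<and>
     card (cycle_edges C \<inter> cycle_edges C') = 3 \<and>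
     (\<exists>e \<in> cycle_edges C \<inter> cycle_edges C'.
        nonmax_weight_edges E w C = {e} \<and> nonmax_weight_edges E w C' = {e})"

definition RAC_case2b ::
  "'a set set \<Rightarrow> ('a set \<Rightarrow> real) \<Rightarrow> 'a list \<Rightarrow> 'a list \<Rightarrow> bool" where
  "RAC_case2b E w C C' \<longleftrightarrow>
     (\<exists>v1 v2 v3 v4 v5 v4'.
        is_cycle E [v1, v2, v3, v4, v5] \<and> cycle_edges C = cycle_edges [v1, v2, v3, v4, v5] \<and>
        is_cycle E [v1, v2, v3, v4', v5] \<and> cycle_edges C' = cycle_edges [v1, v2, v3, v4', v5] \<and>
        v4' \<noteq> v4 \<and>
        \<not> (linked E {v4} {v1} \<and> linked E {v4'} {v1}) \<and>
        \<not> (linked E {v4} {v2} \<and> linked E {v4'} {v2}) \<and>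
        common_nonmax_edges E w C C' = {{v1, v2}})"

definition reinforced_adjacent_cycles_condition ::
  "'a set set \<Rightarrow> ('a set \<Rightarrow> real) \<Rightarrow> bool" where
  "reinforced_adjacent_cycles_condition E w \<longleftrightarrow>
     (\<forall>C C'. is_cycle E C \<longrightarrow> is_cycle E C' \<longrightarrow> adjacent_cycles C C' \<longrightarrow>
        RAC_case1 E w C C' \<or> (RAC_case2a E w C C' \<and> RAC_case2b E w C C') \<longrightarrow>
        linked E (set C - set C') (set C' - set C))"

end

theory Submission
  imports Defs
begin

text \<open>
  On \<open>A\<close> the restricted game of \<open>u\<^sub>S\<close> takes the value 1 or 0 according to whether \<open>S\<close> lies in a single
  block of \<open>A\<close>. Convexity for \<open>S = {x, y}\<close> therefore says that if \<open>x\<close> and \<open>y\<close> share a block of \<open>A\<close> and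
  a block of \<open>B\<close>, they share a block of \<open>A \<inter> B\<close>. For two 4-cycles \<open>p q r s\<close> and \<open>p q r t\<close> take
  \<open>A = {p, q, s, t}\<close> and \<open>B = {r, q, s, t}\<close>: the vertices \<open>s\<close> and \<open>t\<close> are joined through \<open>p\<close>, respectively
  \<open>r\<close>, by edges heavier than \<open>pq\<close>, respectively \<open>qr\<close>, but if \<open>st\<close> is not an edge they are separated in
  \<open>{q, s, t}\<close>, whose only possible edges are \<open>qs\<close> and \<open>qt\<close>. For the 5-cycles the sets
  \<open>{4, 4', 5, 1, 2}\<close> and \<open>{4, 4', 3, 1, 2}\<close> play the same role, the edge \<open>12\<close> being lighter than all others.
\<close>

section \<open>Components, and disjointness of the blocks of the minimum partition\<close>

definition conn_rel :: "'a set \<Rightarrow> 'a set set \<Rightarrow> ('a \<times> 'a) set" where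
  "conn_rel A F = {(x, y). x \<in> A \<and> y \<in> A \<and> (x, y) \<in> {(a, b). {a, b} \<in> F}\<^sup>*}"

lemma components_eq: "components A F = A // conn_rel A F"
  by (simp add: components_def conn_rel_def)

lemma equiv_conn_rel: "equiv A (conn_rel A F)"
proof -
  have "sym ({(a, b). {a, b} \<in> F}\<^sup>*)"
    by (intro sym_rtrancl) (auto simp: sym_def insert_commute)
  then show ?thesis
    unfolding conn_rel_def
    by (intro equivI) (auto simp: refl_on_def sym_def intro!: transI)
qed

lemma components_subset: "K \<in> components A F \<Longrightarrow> K \<subseteq> A"
  unfolding components_eq using equiv_conn_rel by (metis Union_quotient Union_upper)

lemma components_unique:
  "\<lbrakk>K \<in> components A F; K' \<in> components A F; z \<in> K; z \<in> K'\<rbrakk> \<Longrightarrow> K = K'"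
  unfolding components_eq using quotient_disj[OF equiv_conn_rel] by blast

lemma component_of: "x \<in> A \<Longrightarrow> conn_rel A F `` {x} \<in> components A F"
  unfolding components_eq by (rule quotientI)

lemma finite_components: "finite A \<Longrightarrow> finite (components A F)"
  by (meson PowI components_subset finite_Pow_iff finite_subset subsetI)

lemma P_min_subset: "F \<in> P_min E w K \<Longrightarrow> F \<subseteq> K"
  unfolding P_min_def by (rule components_subset)

text \<open>A common vertex \<open>z\<close> first forces the two components of the induced graph to
  coincide, since each block lies inside its component; then both blocks are components of one and
  the same graph on \<open>K\<close>.\<close>

lemma P_min_tilde_unique:
  assumes "F \<in> P_min_tilde E w A" "F' \<in> P_min_tilde E w A" "z \<in> F" "z \<in> F'"
  shows "F = F'"
proof -
  obtain K K' where K: "K \<in> components A (edges_in E A)" "F \<in> P_min E w K"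
    and K': "K' \<in> components A (edges_in E A)" "F' \<in> P_min E w K'"
    using assms unfolding P_min_tilde_def by blast
  have "K = K'"
    using components_unique K K' assms(3,4) P_min_subset by (metis subsetD)
  then show ?thesis
    using components_unique K(2) K'(2) assms(3,4) unfolding P_min_def by metis
qed

lemma finite_P_min_tilde: "finite A \<Longrightarrow> finite (P_min_tilde E w A)"
  unfolding P_min_tilde_def P_min_def
  by (meson components_subset finite_UN_I finite_components finite_subset)

section \<open>Sharing a block: link with convexity, and criteria for and against it\<close>

definition same_block :: "'a set set \<Rightarrow> ('a set \<Rightarrow> real) \<Rightarrow> 'a set \<Rightarrow> 'a \<Rightarrow> 'a \<Rightarrow> bool" where
  "same_block E w A x y \<longleftrightarrow> (\<exists>F \<in> P_min_tilde E w A. x \<in> F \<and> y \<in> F)"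

lemma same_block_sym: "same_block E w A x y \<Longrightarrow> same_block E w A y x"
  unfolding same_block_def by blast

lemma same_block_trans:
  "\<lbrakk>same_block E w A x y; same_block E w A y z\<rbrakk> \<Longrightarrow> same_block E w A x z"
  unfolding same_block_def using P_min_tilde_unique by metis

text \<open>Blocks are disjoint, so at most one of them contains both \<open>x\<close> and
  \<open>y\<close>, and the sum has at most one nonzero term.\<close>

lemma restricted_unanimity_pair:
  assumes "finite A"
  shows "restricted_game E w (unanimity_game {x, y}) A = (if same_block E w A x y then 1 else 0)"
proof (cases "same_block E w A x y")
  case True
  then obtain F where F: "F \<in> P_min_tilde E w A" "x \<in> F" "y \<in> F"
    unfolding same_block_def by blast
  have val: "unanimity_game {x, y} F' = (if F' = F then 1 else 0)" if "F' \<in> P_min_tilde E w A" for F'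
    using F P_min_tilde_unique[OF that F(1)] by (auto simp: unanimity_game_def)
  have "restricted_game E w (unanimity_game {x, y}) A
      = (\<Sum>F' \<in> P_min_tilde E w A. if F' = F then 1 else 0)"
    unfolding restricted_game_def by (rule sum.cong[OF refl val])
  also have "\<dots> = 1"
    using F(1) finite_P_min_tilde[OF assms] by simp
  finally show ?thesis using True by simp
next
  case False
  then have "unanimity_game {x, y} F = 0" if "F \<in> P_min_tilde E w A" for F
    using that by (simp add: same_block_def unanimity_game_def)
  then show ?thesis using False by (simp add: restricted_game_def)
qed

text \<open>The game is 1 on \<open>A\<close> and on \<open>B\<close> and never exceeds 1, so the
  sum of its values on union and intersection can reach 2 only if both are 1.\<close>

lemma same_block_Int:
  assumes conv: "convex_game N (restricted_game E w (unanimity_game {x, y}))"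
    and N: "finite N" "A \<subseteq> N" "B \<subseteq> N"
    and A: "same_block E w A x y" and B: "same_block E w B x y"
  shows "same_block E w (A \<inter> B) x y"
proof -
  let ?v = "restricted_game E w (unanimity_game {x, y})"
  have "finite A" "finite B" using N finite_subset by auto
  moreover have "?v A + ?v B \<le> ?v (A \<union> B) + ?v (A \<inter> B)"
    using conv N(2,3) unfolding convex_game_def by blast
  ultimately show ?thesis
    using A B by (simp add: restricted_unanimity_pair split: if_splits)
qed

text \<open>The path from \<open>x\<close> to \<open>p\<close> places the lighter edge
  \<open>{p, q}\<close> in the component of \<open>{x, y}\<close>. Hence \<open>{x, y}\<close> is
  not of minimum weight there and survives the deletion.\<close>

lemma same_block_edge:
  assumes "{x, y} \<in> E" "x \<in> A" "y \<in> A" "{p, q} \<in> E" "p \<in> A" "q \<in> A"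
    and xp: "(x, p) \<in> {(a, b). {a, b} \<in> edges_in E A}\<^sup>*"
    and less: "w {p, q} < w {x, y}"
  shows "same_block E w A x y"
proof -
  let ?R = "{(a, b). {a, b} \<in> edges_in E A}"
  define K where "K = conn_rel A (edges_in E A) `` {x}"
  define F where "F = edges_in E K - min_edges E w K"
  have "(x, y) \<in> ?R" "(p, q) \<in> ?R"
    using assms by (auto simp: edges_in_def)
  then have "(x, y) \<in> ?R\<^sup>*" "(x, q) \<in> ?R\<^sup>*"
    using xp by (blast intro: rtrancl_into_rtrancl)+
  then have K: "x \<in> K" "y \<in> K" "p \<in> K" "q \<in> K"
    using xp assms by (auto simp: K_def conn_rel_def)
  then have "{x, y} \<in> edges_in E K" "{p, q} \<in> edges_in E K"
    using assms(1,4) by (auto simp: edges_in_def)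
  then have "{x, y} \<in> F"
    using less by (force simp: F_def min_edges_def)
  then have "y \<in> conn_rel K F `` {x}" "x \<in> conn_rel K F `` {x}"
    using K by (auto simp: conn_rel_def)
  moreover have "K \<in> components A (edges_in E A)"
    unfolding K_def by (rule component_of[OF assms(2)])
  then have "conn_rel K F `` {x} \<in> P_min_tilde E w A"
    unfolding P_min_tilde_def P_min_def F_def using component_of[OF K(1)] by blast
  ultimately show ?thesis unfolding same_block_def by blast
qed

text \<open>A cut argument: every edge leaving \<open>X\<close> has minimum weight in
  \<open>A\<close>, hence also in its component, and is deleted. A path of surviving edges that
  starts in \<open>X\<close> therefore never leaves \<open>X\<close>.\<close>

lemma not_same_block:
  assumes x: "x \<in> X" and y: "y \<notin> X"
    and cut: "\<And>a b f. \<lbrakk>a \<in> X; b \<notin> X; {a, b} \<in> edges_in E A; f \<in> edges_in E A\<rbrakk> \<Longrightarrow> w {a, b} \<le> w f"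
  shows "\<not> same_block E w A x y"
proof
  assume "same_block E w A x y"
  then obtain K F where K: "K \<in> components A (edges_in E A)"
    and F: "F \<in> P_min E w K" "x \<in> F" "y \<in> F"
    unfolding same_block_def P_min_tilde_def by blast
  let ?G = "edges_in E K - min_edges E w K"
  have "K \<subseteq> A" using K by (rule components_subset)
  then have sub: "edges_in E K \<subseteq> edges_in E A" by (auto simp: edges_in_def)
  have "(x, y) \<in> conn_rel K ?G"
    using F quotient_eq_iff[OF equiv_conn_rel] unfolding P_min_def components_eq by metis
  then have "(x, y) \<in> {(a, b). {a, b} \<in> ?G}\<^sup>*" by (simp add: conn_rel_def)
  then have "y \<in> X"
  proof induction
    case base
    show ?case by (rule x)
  next
    case (step b c)
    show ?case
    proof (rule ccontr)
      assume "c \<notin> X"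
      then have "{b, c} \<in> min_edges E w K"
        using step cut sub unfolding min_edges_def by blast
      then show False using step by blast
    qed
  qed
  then show False using y by simp
qed

section \<open>Edges, vertices and maximum weight of a cycle given as a list\<close>

lemma cycle_edges_image:
  "cycle_edges C = (\<lambda>i. {C ! i, C ! (Suc i mod length C)}) ` {..<length C}"
  by (auto simp: cycle_edges_def)

lemma edges_chords_eq:
  assumes "is_cycle E C"
  shows "edges_chords E C = edges_in E (set C)"
proof -
  have "e \<subseteq> set C" if "e \<in> cycle_edges C" for e
    using that assms unfolding cycle_edges_def is_cycle_def
    by (auto intro!: nth_mem mod_less_divisor)
  then show ?thesis
    using assms unfolding edges_chords_def chords_def edges_in_def is_cycle_def by blast
qed

text \<open>Recovers the vertex set from the edge set, so that two labellings with equal edge sets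
  have the same vertices.\<close>

lemma Union_cycle_edges:
  assumes "is_cycle E C"
  shows "\<Union> (cycle_edges C) = set C"
proof
  show "\<Union> (cycle_edges C) \<subseteq> set C"
    using edges_chords_eq[OF assms] by (auto simp: edges_chords_def edges_in_def)
  show "set C \<subseteq> \<Union> (cycle_edges C)"
    unfolding cycle_edges_def in_set_conv_nth subset_iff by blast
qed

lemma card_cycle_edges:
  assumes "is_cycle E C"
  shows "card (cycle_edges C) = length C"
proof -
  let ?n = "length C"
  let ?e = "\<lambda>i. {C ! i, C ! (Suc i mod ?n)}"
  have n: "?n \<ge> 3" and d: "distinct C" using assms by (auto simp: is_cycle_def)
  have "inj_on ?e {..<?n}"
  proof (rule inj_onI, rule ccontr)
    fix i j assume ij: "i \<in> {..<?n}" "j \<in> {..<?n}" "?e i = ?e j" "i \<noteq> j"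
    have lt: "Suc i mod ?n < ?n" "Suc j mod ?n < ?n" using ij(1) by (auto intro!: mod_less_divisor)
    \<comment> \<open>Equal edges at different positions must have their ends crossed, so each
      position is the cyclic successor of the other. That needs a length of at most 2.\<close>
    have "i = Suc j mod ?n" "j = Suc i mod ?n"
      using ij lt d by (auto simp: doubleton_eq_iff nth_eq_iff_index_eq)
    moreover have "Suc k mod ?n = (if Suc k = ?n then 0 else Suc k)" if "k \<in> {..<?n}" for k
      using that by auto
    ultimately show False
      using n ij(1,2) by (auto split: if_splits)
  qed
  then show ?thesis by (simp add: cycle_edges_image card_image)
qed

lemma cycle_edges_4: "cycle_edges [a, b, c, d] = {{a, b}, {b, c}, {c, d}, {d, a}}"
proof -
  have "{..<length [a, b, c, d]} = {0, 1, 2, 3}" by auto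
  then show ?thesis unfolding cycle_edges_image by simp
qed

lemma cycle_edges_5: "cycle_edges [a, b, c, d, e] = {{a, b}, {b, c}, {c, d}, {d, e}, {e, a}}"
proof -
  have "{..<length [a, b, c, d, e]} = {0, 1, 2, 3, 4}" by auto
  then show ?thesis unfolding cycle_edges_image by simp
qed

text \<open>Replaces \<open>Max\<close> by an edge \<open>m\<close> attaining it: an edge of the
  induced graph is non-maximum exactly when it is lighter than \<open>m\<close>.\<close>

lemma maximum_edge:
  assumes "finite E" "is_cycle E C"
  obtains m where "m \<in> edges_in E (set C)"
    and "\<And>e. e \<in> nonmax_weight_edges E w C \<longleftrightarrow> e \<in> edges_in E (set C) \<and> w e < w m"
proof -
  let ?S = "edges_in E (set C)"
  have eq: "edges_chords E C = ?S" using assms(2) by (rule edges_chords_eq)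
  have fin: "finite ?S" using assms(1) by (auto simp: edges_in_def)
  have "cycle_edges C \<noteq> {}" using card_cycle_edges[OF assms(2)] assms(2) by (auto simp: is_cycle_def)
  then have "?S \<noteq> {}" using eq by (auto simp: edges_chords_def)
  then have "Max (w ` ?S) \<in> w ` ?S" using fin by simp
  then obtain m where m: "m \<in> ?S" "w m = Max (w ` ?S)" by auto
  have "w e \<le> w m" if "e \<in> ?S" for e using that fin m(2) by simp
  then have "e \<in> nonmax_weight_edges E w C \<longleftrightarrow> e \<in> ?S \<and> w e < w m" for e
    unfolding nonmax_weight_edges_def max_weight_edges_def eq using m by force
  then show thesis using that m by blast
qed

section \<open>Consequences of convexity for light edges\<close>

locale convex_restricted =
  fixes N :: "'a set" and E :: "'a set set" and w :: "'a set \<Rightarrow> real"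
  assumes graph: "simple_graph N E"
    and convex: "\<And>S. S \<noteq> {} \<Longrightarrow> S \<subseteq> N \<Longrightarrow> convex_game N (restricted_game E w (unanimity_game S))"
begin

lemma finite_N: "finite N" and finite_E: "finite E"
  using graph unfolding simple_graph_def by (auto intro: finite_subset[of E "Pow N"])

lemma edge_in_N: "{a, b} \<in> E \<Longrightarrow> a \<in> N \<and> b \<in> N \<and> a \<noteq> b"
  using graph unfolding simple_graph_def by fastforce

lemma edges_inE:
  assumes "f \<in> edges_in E A"
  obtains a b where "f = {a, b}" "a \<noteq> b" "a \<in> A" "b \<in> A" "{a, b} \<in> E"
proof -
  have "f \<in> E" "f \<subseteq> A" "card f = 2"
    using assms graph by (auto simp: edges_in_def simple_graph_def)
  then show thesis using that by (auto simp: card_2_iff)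
qed

lemma blocks_Int:
  assumes "x \<in> N" "y \<in> N" "A \<subseteq> N" "B \<subseteq> N"
    and "same_block E w A x y" "same_block E w B x y"
  shows "same_block E w (A \<inter> B) x y"
  using same_block_Int[OF convex finite_N] assms by simp

text \<open>If \<open>a\<close> and \<open>d\<close> differed, the lighter edges would keep
  \<open>{b, c}\<close> in the partitions of \<open>{a, b, c}\<close> and \<open>{d, b, c}\<close>.
  On the intersection \<open>{b, c}\<close> it is the only edge, so it is deleted. The ends
  \<open>b'\<close> and \<open>c'\<close> may agree or differ, which covers stars and paths
  alike.\<close>

lemma lower_edges_common_end:
  assumes bc: "{b, c} \<in> E"
    and a: "{b', a} \<in> E" "b' \<in> {b, c}" "a \<notin> {b, c}" "w {b', a} < w {b, c}"
    and d: "{c', d} \<in> E" "c' \<in> {b, c}" "d \<notin> {b, c}" "w {c', d} < w {b, c}"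
  shows "a = d"
proof (rule ccontr)
  assume "a \<noteq> d"
  then have Int: "{a, b, c} \<inter> {d, b, c} = {b, c}" using a d by auto
  have block: "same_block E w {z, b, c} b c"
    if z: "{u, z} \<in> E" "u \<in> {b, c}" "w {u, z} < w {b, c}" for u z
  proof (rule same_block_edge[where p = u and q = z])
    show "(b, u) \<in> {(p, q). {p, q} \<in> edges_in E {z, b, c}}\<^sup>*"
      using z(2) bc by (auto simp: edges_in_def)
  qed (use z bc in auto)
  have "same_block E w ({a, b, c} \<inter> {d, b, c}) b c"
    by (rule blocks_Int) (use edge_in_N bc a d block in blast)+
  moreover have "\<not> same_block E w {b, c} b c"
  proof (rule not_same_block[where X = "{b}"])
    have single: "f = {b, c}" if "f \<in> edges_in E {b, c}" for f
      using that by (rule edges_inE) auto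
    show "w {u, v} \<le> w f" if "{u, v} \<in> edges_in E {b, c}" "f \<in> edges_in E {b, c}" for u v f
      using that[THEN single] by simp
  qed (use edge_in_N[OF bc] in auto)
  ultimately show False unfolding Int by simp
qed

lemma lower_edge_bound:
  assumes "{b, c} \<in> E"
    and "{b', a} \<in> E" "b' \<in> {b, c}" "a \<notin> {b, c}" "w {b', a} < w {b, c}"
    and "{c', d} \<in> E" "c' \<in> {b, c}" "d \<notin> {b, c}" "a \<noteq> d"
  shows "w {b, c} \<le> w {c', d}"
  using lower_edges_common_end assms not_less by metis

text \<open>Also rules out two 4-cycles on the same four vertices that share two opposite edges.\<close>

lemma opposite_edges_not_both_lower:
  assumes d: "distinct [p, q, r, s]"
    and E: "{p, q} \<in> E" "{r, s} \<in> E"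
    and m: "m \<in> edges_in E {p, q, r, s}" "w {p, q} < w m" "w {r, s} < w m"
  shows False
proof -
  obtain x y where xy: "m = {x, y}" "x \<noteq> y" "x \<in> {p, q, r, s}" "y \<in> {p, q, r, s}" "{x, y} \<in> E"
    using m(1) by (rule edges_inE)
  \<comment> \<open>Being heavier than both \<open>{p, q}\<close> and \<open>{r, s}\<close>, the
    edge \<open>m\<close> must join one of these pairs to the other.\<close>
  have "m = {p, r} \<or> m = {p, s} \<or> m = {q, r} \<or> m = {q, s}"
    using xy m by (auto simp: insert_commute)
  \<comment> \<open>Here \<open>u'\<close> and \<open>v'\<close> are the partners of the ends of
    \<open>m\<close>: two lighter edges leave \<open>m\<close> towards different vertices.\<close>
  moreover have ne: "m \<noteq> {u, v}"
    if uv: "{u, u'} = {p, q}" "{v, v'} = {r, s}" "distinct [u, u', v, v']" for u u' v v'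
  proof
    assume "m = {u, v}"
    moreover have "u' \<notin> {u, v}" "v' \<notin> {u, v}" using uv(3) by auto
    ultimately have "u' = v'"
      using lower_edges_common_end[of u v u u' v v'] uv(1,2) E m(2,3) xy(1,5) by simp
    then show False using uv(3) by simp
  qed
  ultimately show False
    using ne[of p q r s] ne[of p q s r] ne[of q p r s] ne[of q p s r] d
    by (auto simp: insert_commute)
qed

text \<open>Unless \<open>m\<close> is \<open>{q, s}\<close>, a lighter edge leads from
  \<open>m\<close> to \<open>q\<close>, so by \<open>lower_edge_bound\<close> every edge from
  \<open>m\<close> to the fourth vertex weighs at least \<open>w m\<close>. Thus
  \<open>{s, p}\<close> and \<open>{r, s}\<close> both reach \<open>w m\<close>.\<close>

lemma consecutive_lower_edges:
  assumes d: "distinct [p, q, r, s]"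
    and E: "{p, q} \<in> E" "{q, r} \<in> E" "{r, s} \<in> E" "{s, p} \<in> E"
    and m: "m \<in> edges_in E {p, q, r, s}" "w {p, q} < w m" "w {q, r} < w m"
  shows "w {p, q} < w {s, p}" "w {q, r} < w {r, s}"
proof -
  note star = lower_edge_bound
  obtain x y where xy: "m = {x, y}" "x \<noteq> y" "x \<in> {p, q, r, s}" "y \<in> {p, q, r, s}" "{x, y} \<in> E"
    using m(1) by (rule edges_inE)
  have E': "{q, p} \<in> E" "{r, q} \<in> E" "{s, r} \<in> E" "{p, s} \<in> E"
    using E by (simp_all add: insert_commute)
  have comm: "{q, p} = {p, q}" "{r, q} = {q, r}" "{s, r} = {r, s}" "{p, s} = {s, p}"
    by (simp_all add: insert_commute)
  have d': "p \<noteq> q" "p \<noteq> r" "p \<noteq> s" "q \<noteq> r" "q \<noteq> s" "r \<noteq> s"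
    "q \<noteq> p" "r \<noteq> p" "s \<noteq> p" "r \<noteq> q" "s \<noteq> q" "s \<noteq> r"
    using d by auto
  have mE: "m \<in> E" using xy by simp
  have "m = {p, r} \<or> m = {q, s} \<or> m = {r, s} \<or> m = {s, p}"
    using xy m by (auto simp: insert_commute)
  then have "w m \<le> w {s, p} \<and> w m \<le> w {r, s}"
  proof (elim disjE)
    assume m': "m = {p, r}"
    have "w {p, r} \<le> w {p, s}" "w {p, r} \<le> w {r, s}"
      using star[of p r p q p s] star[of p r p q r s] d' E E' m(2,3) mE m' by simp_all
    then show ?thesis using m' comm by simp
  next
    \<comment> \<open>This case is contradictory: the lighter edge to \<open>p\<close> would force
      \<open>{q, r}\<close> to weigh at least \<open>w m\<close>.\<close>
    assume m': "m = {q, s}"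
    have "w {q, s} \<le> w {q, r}"
      using star[of q s q p q r] d' E E' m(2,3) mE comm m' by simp
    then show ?thesis using m(3) m' by simp
  next
    assume m': "m = {r, s}"
    have "w {r, s} \<le> w {s, p}"
      using star[of r s r q s p] d' E E' m(2,3) mE comm m' by simp
    then show ?thesis using m' by simp
  next
    assume m': "m = {s, p}"
    have "w {s, p} \<le> w {s, r}"
      using star[of s p p q s r] d' E E' m(2,3) mE comm m' by simp
    then show ?thesis using m' comm by simp
  qed
  then show "w {p, q} < w {s, p}" "w {q, r} < w {r, s}" using m by auto
qed

section \<open>The case of two 4-cycles\<close>

text \<open>Two non-maximum edges of a 4-cycle cannot be opposite, so they meet in a vertex
  \<open>q\<close>. Fixing \<open>e\<close> as the first and \<open>f\<close> as the second edge
  makes the labellings of two cycles comparable.\<close>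

lemma four_cycle_labelling:
  assumes C: "is_cycle E C" "card (cycle_edges C) = 4"
    and e: "e \<in> cycle_edges C" "e \<in> nonmax_weight_edges E w C"
    and f: "f \<in> cycle_edges C" "f \<in> nonmax_weight_edges E w C"
    and "e \<noteq> f"
  obtains p q r s where "distinct [p, q, r, s]" "e = {p, q}" "f = {q, r}"
    "cycle_edges C = {{p, q}, {q, r}, {r, s}, {s, p}}" "set C = {p, q, r, s}"
    "w {p, q} < w {s, p}" "w {q, r} < w {r, s}"
proof -
  have "length C = 4" using C card_cycle_edges by metis
  then obtain a b c d where abcd: "C = [a, b, c, d]"
    by (auto simp: length_Suc_conv numeral_eq_Suc)
  \<comment> \<open>The valid labellings of \<open>C\<close>. Rotations bring \<open>e\<close> to
    the first place; if \<open>f\<close> then precedes \<open>e\<close>, the reversal turns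
    \<open>{p, s}\<close> into the second edge.\<close>
  define L where "L p q r s \<longleftrightarrow> distinct [p, q, r, s] \<and>
    cycle_edges C = {{p, q}, {q, r}, {r, s}, {s, p}} \<and> set C = {p, q, r, s}" for p q r s
  have rotate: "L q r s p" if "L p q r s" for p q r s
  proof -
    have "{{p, q}, {q, r}, {r, s}, {s, p}} = {{q, r}, {r, s}, {s, p}, {p, q}}"
      "{p, q, r, s} = {q, r, s, p}" by blast+
    moreover have "distinct [q, r, s, p]" using that unfolding L_def by auto
    ultimately show ?thesis using that unfolding L_def by simp
  qed
  have reverse: "L q p s r" if "L p q r s" for p q r s
  proof -
    have "{{q, p}, {p, s}, {s, r}, {r, q}} = {{p, q}, {s, p}, {r, s}, {q, r}}"
      by (simp only: insert_commute)
    also have "\<dots> = {{p, q}, {q, r}, {r, s}, {s, p}}" by blast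
    finally have "cycle_edges C = {{q, p}, {p, s}, {s, r}, {r, q}}"
      using that unfolding L_def by simp
    moreover have "distinct [q, p, s, r]" "set C = {q, p, s, r}" using that unfolding L_def by auto
    ultimately show ?thesis unfolding L_def by simp
  qed
  have CE: "cycle_edges C \<subseteq> E" using C unfolding is_cycle_def by simp
  obtain m where m: "m \<in> edges_in E (set C)" "w e < w m" "w f < w m"
    using maximum_edge[OF finite_E C(1)] e f by metis
  have L: "L a b c d"
    using C(1) unfolding L_def is_cycle_def abcd cycle_edges_4 by simp
  obtain p q r s where pqrs: "L p q r s" "e = {p, q}"
    using e(1) that L rotate[OF L] rotate[OF rotate[OF L]] rotate[OF rotate[OF rotate[OF L]]]
    unfolding abcd cycle_edges_4 by blast
  have "f \<noteq> {r, s}"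
    using opposite_edges_not_both_lower[of p q r s m] pqrs m CE unfolding L_def by auto
  moreover have "f \<in> {{p, q}, {q, r}, {r, s}, {s, p}}"
    using f(1) pqrs(1) unfolding L_def by simp
  ultimately have "f = {q, r} \<or> f = {p, s}"
    using \<open>e \<noteq> f\<close> pqrs(2) by (auto simp: insert_commute)
  then have "\<exists>p q r s. L p q r s \<and> e = {p, q} \<and> f = {q, r}"
    using pqrs reverse[OF pqrs(1)] insert_commute[of p q "{}"] by metis
  then obtain p q r s where L: "distinct [p, q, r, s]" "e = {p, q}" "f = {q, r}"
    "cycle_edges C = {{p, q}, {q, r}, {r, s}, {s, p}}" "set C = {p, q, r, s}"
    unfolding L_def by (elim exE conjE) (rule that)
  moreover have "{p, q} \<in> E" "{q, r} \<in> E" "{r, s} \<in> E" "{s, p} \<in> E"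
    using CE L(4) by auto
  ultimately show thesis
    using that consecutive_lower_edges[of p q r s m] m by simp
qed

lemma RAC_case1_linked:
  assumes C: "is_cycle E C" and C': "is_cycle E C'" and adj: "adjacent_cycles C C'"
    and case1: "RAC_case1 E w C C'"
  shows "linked E (set C - set C') (set C' - set C)"
proof (rule ccontr)
  assume unlinked: "\<not> ?thesis"
  have "card (common_nonmax_edges E w C C') = 2" "card (cycle_edges C) = 4" "card (cycle_edges C') = 4"
    using case1 by (auto simp: RAC_case1_def)
  then obtain e f where ef: "common_nonmax_edges E w C C' = {e, f}" "e \<noteq> f"
    by (auto simp: card_2_iff)
  then have "e \<in> common_nonmax_edges E w C C'" "f \<in> common_nonmax_edges E w C C'"
    by simp_all
  then have mem: "e \<in> cycle_edges C" "e \<in> nonmax_weight_edges E w C"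
    "f \<in> cycle_edges C" "f \<in> nonmax_weight_edges E w C"
    "e \<in> cycle_edges C'" "e \<in> nonmax_weight_edges E w C'"
    "f \<in> cycle_edges C'" "f \<in> nonmax_weight_edges E w C'"
    unfolding common_nonmax_edges_def by simp_all
  obtain p q r s where L: "distinct [p, q, r, s]" "e = {p, q}" "f = {q, r}"
    "cycle_edges C = {{p, q}, {q, r}, {r, s}, {s, p}}" "set C = {p, q, r, s}"
    "w {p, q} < w {s, p}" "w {q, r} < w {r, s}"
    using four_cycle_labelling[OF C \<open>card (cycle_edges C) = 4\<close> mem(1-4) ef(2)] .
  obtain p' q' r' t where L': "distinct [p', q', r', t]" "e = {p', q'}" "f = {q', r'}"
    "cycle_edges C' = {{p', q'}, {q', r'}, {r', t}, {t, p'}}" "set C' = {p', q', r', t}"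
    "w {p', q'} < w {t, p'}" "w {q', r'} < w {r', t}"
    using four_cycle_labelling[OF C' \<open>card (cycle_edges C') = 4\<close> mem(5-8) ef(2)] .
  \<comment> \<open>The common vertex of \<open>e\<close> and \<open>f\<close> is \<open>q\<close>
    in both labellings, and this fixes the other ends.\<close>
  have same: "p' = p" "q' = q" "r' = r"
    using L(1,2,3) L'(1,2,3) by (auto simp: doubleton_eq_iff)
  note L' = L'[unfolded same]
  have "t \<noteq> s" using adj L(4) L'(4) by (auto simp: adjacent_cycles_def)
  then have diff: "set C - set C' = {s}" "set C' - set C = {t}"
    using L(1,5) L'(1,5) by auto
  then have st: "{s, t} \<notin> E" using unlinked by (auto simp: linked_def)
  have E: "{p, q} \<in> E" "{q, r} \<in> E" "{r, s} \<in> E" "{s, p} \<in> E" "{r, t} \<in> E" "{t, p} \<in> E"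
    using C C' L(4) L'(4) by (auto simp: is_cycle_def)
  have V: "p \<in> N" "q \<in> N" "r \<in> N" "s \<in> N" "t \<in> N"
    using edge_in_N E by blast+
  \<comment> \<open>Used with \<open>z\<close> equal to \<open>p\<close> and to \<open>r\<close>:
    the light edge \<open>{z, q}\<close> protects both \<open>{s, z}\<close> and
    \<open>{t, z}\<close> from deletion.\<close>
  have block: "same_block E w {z, q, s, t} s t"
    if "{z, q} \<in> E" "{s, z} \<in> E" "{t, z} \<in> E" "w {z, q} < w {s, z}" "w {z, q} < w {t, z}" for z
  proof -
    have "same_block E w {z, q, s, t} u z" if "{u, z} \<in> E" "u \<in> {s, t}" "w {z, q} < w {u, z}" for u
      by (rule same_block_edge[where p = z and q = q])
        (use that \<open>{z, q} \<in> E\<close> in \<open>auto simp: edges_in_def\<close>)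
    then show ?thesis
      using that same_block_sym same_block_trans by (metis insertCI)
  qed
  have "same_block E w ({p, q, s, t} \<inter> {r, q, s, t}) s t"
  proof (rule blocks_Int)
    show "same_block E w {p, q, s, t} s t" "same_block E w {r, q, s, t} s t"
      using block[of p] block[of r] E L(6,7) L'(6,7) by (auto simp: insert_commute)
  qed (use V in simp_all)
  moreover have "{p, q, s, t} \<inter> {r, q, s, t} = {q, s, t}" using L(1) by auto
  moreover have "\<not> same_block E w {q, s, t} s t"
  proof -
    have D: "f = {q, s} \<or> f = {q, t}" if "f \<in> edges_in E {q, s, t}" for f
      using that st by (elim edges_inE) (auto simp: insert_commute)
    have dist: "q \<noteq> s" "q \<noteq> t" using L(1) L'(1) by auto
    show ?thesis
      \<comment> \<open>the cut has to be crossed only by the lightest edge\<close>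
    proof (cases "{q, s} \<in> E \<and> w {q, t} < w {q, s}")
      case True
      show ?thesis
        by (rule not_same_block[where X = "{s, q}"])
          (use True dist \<open>t \<noteq> s\<close> in \<open>auto dest!: D simp: doubleton_eq_iff\<close>)
    next
      case False
      show ?thesis
      proof (rule not_same_block[where X = "{s}"])
        fix a b f
        assume "a \<in> {s}" and ab: "{a, b} \<in> edges_in E {q, s, t}" and f: "f \<in> edges_in E {q, s, t}"
        then have "{a, b} = {q, s}" using D[OF ab] dist \<open>t \<noteq> s\<close> by auto
        moreover from this have "w {q, s} \<le> w {q, t}"
          using ab False by (simp add: edges_in_def)
        ultimately show "w {a, b} \<le> w f" using D[OF f] by auto
      qed (use \<open>t \<noteq> s\<close> in auto)
    qed
  qed
  ultimately show False by simp
qed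

section \<open>The case of two 5-cycles\<close>

lemma RAC_case2_linked:
  assumes C: "is_cycle E C" and C': "is_cycle E C'"
    and a: "RAC_case2a E w C C'" and b: "RAC_case2b E w C C'"
  shows "linked E (set C - set C') (set C' - set C)"
proof (rule ccontr)
  assume unlinked: "\<not> ?thesis"
  obtain v1 v2 v3 v4 v5 v4' where
    L: "is_cycle E [v1, v2, v3, v4, v5]" "cycle_edges C = cycle_edges [v1, v2, v3, v4, v5]"
    and L': "is_cycle E [v1, v2, v3, v4', v5]" "cycle_edges C' = cycle_edges [v1, v2, v3, v4', v5]"
    and v4: "v4' \<noteq> v4"
      "\<not> (linked E {v4} {v1} \<and> linked E {v4'} {v1})"
      "\<not> (linked E {v4} {v2} \<and> linked E {v4'} {v2})"
    and common: "common_nonmax_edges E w C C' = {{v1, v2}}"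
    using b unfolding RAC_case2b_def by (elim exE conjE) (rule that)
  obtain e where e: "nonmax_weight_edges E w C = {e}" "nonmax_weight_edges E w C' = {e}"
    using a unfolding RAC_case2a_def by (elim bexE conjE) (rule that)
  \<comment> \<open>Identifies the single non-maximum edge \<open>e\<close> of part (a) with the
    edge \<open>{v1, v2}\<close> singled out by the labelling of part (b).\<close>
  have "{v1, v2} \<in> common_nonmax_edges E w C C'" using common by simp
  then have "{v1, v2} = e" unfolding common_nonmax_edges_def e by simp
  then have nonmax: "nonmax_weight_edges E w C = {{v1, v2}}" "nonmax_weight_edges E w C' = {{v1, v2}}"
    using e by simp_all
  have set: "set C = {v1, v2, v3, v4, v5}" "set C' = {v1, v2, v3, v4', v5}"
    using Union_cycle_edges[OF C] Union_cycle_edges[OF C'] Union_cycle_edges[OF L(1)]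
      Union_cycle_edges[OF L'(1)] L(2) L'(2) by simp_all
  have dist: "distinct [v1, v2, v3, v4, v5]" "distinct [v1, v2, v3, v4', v5]"
    using L(1) L'(1) by (auto simp: is_cycle_def)
  have E: "{v1, v2} \<in> E" "{v2, v3} \<in> E" "{v3, v4} \<in> E" "{v4, v5} \<in> E" "{v5, v1} \<in> E"
    "{v3, v4'} \<in> E" "{v4', v5} \<in> E"
    using L(1) L'(1) unfolding is_cycle_def cycle_edges_5 by auto
  have V: "v1 \<in> N" "v2 \<in> N" "v3 \<in> N" "v4 \<in> N" "v5 \<in> N" "v4' \<in> N"
    using edge_in_N E by blast+
  have "set C - set C' = {v4}" "set C' - set C = {v4'}"
    using set dist v4(1) by auto
  then have v44': "{v4, v4'} \<notin> E" using unlinked by (auto simp: linked_def)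
  \<comment> \<open>Chords count as well: every other edge inside \<open>set C\<close> or
    \<open>set C'\<close> has the maximum weight of that cycle, while \<open>{v1, v2}\<close> lies
    below it.\<close>
  have less: "w {v1, v2} < w f"
    if "f \<in> E" "f \<noteq> {v1, v2}" "f \<subseteq> set C \<or> f \<subseteq> set C'" for f
  proof -
    have "w {v1, v2} < w f" if D: "is_cycle E D" "nonmax_weight_edges E w D = {{v1, v2}}" "f \<subseteq> set D" for D
    proof -
      obtain m where "\<And>e. e \<in> nonmax_weight_edges E w D \<longleftrightarrow> e \<in> edges_in E (set D) \<and> w e < w m"
        using maximum_edge[OF finite_E D(1)] by metis
      then show ?thesis
        using D(2,3) \<open>f \<in> E\<close> \<open>f \<noteq> {v1, v2}\<close> unfolding edges_in_def
        by (metis (mono_tags, lifting) insertI1 linorder_not_less mem_Collect_eq order_less_le_trans singletonD)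
    qed
    then show ?thesis using that C C' nonmax by blast
  qed
  \<comment> \<open>The edge from \<open>z\<close> to \<open>v1\<close> or \<open>v2\<close> only
    serves to bring the light edge \<open>{v1, v2}\<close> into the component of \<open>z\<close>;
    the path through \<open>z\<close> then survives.\<close>
  have block: "same_block E w {v4, v4', z, v1, v2} v4 v4'"
    if z: "{v4, z} \<in> E" "{v4', z} \<in> E" "{z, v1} \<in> E \<or> {z, v2} \<in> E" "z = v3 \<or> z = v5" for z
  proof -
    have "same_block E w {v4, v4', z, v1, v2} z u" if u: "u = v4 \<or> u = v4'" for u
    proof -
      obtain p q where pq: "{p, q} = {v1, v2}" "{z, p} \<in> E"
        using z(3) by (metis insert_commute)
      show ?thesis
      proof (rule same_block_edge[where p = p and q = q])
        show "w {p, q} < w {z, u}"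
          unfolding pq by (rule less) (use z u set dist in \<open>auto simp: insert_commute doubleton_eq_iff\<close>)
        show "(z, p) \<in> {(a, b). {a, b} \<in> edges_in E {v4, v4', z, v1, v2}}\<^sup>*"
          using pq by (auto simp: edges_in_def doubleton_eq_iff)
      qed (use z u pq E in \<open>auto simp: insert_commute doubleton_eq_iff\<close>)
    qed
    then show ?thesis using same_block_sym same_block_trans by metis
  qed
  have "same_block E w ({v4, v4', v5, v1, v2} \<inter> {v4, v4', v3, v1, v2}) v4 v4'"
  proof (rule blocks_Int)
    show "same_block E w {v4, v4', v5, v1, v2} v4 v4'" "same_block E w {v4, v4', v3, v1, v2} v4 v4'"
      using block[of v5] block[of v3] E by (auto simp: insert_commute)
  qed (use V in simp_all)
  moreover have "{v4, v4', v5, v1, v2} \<inter> {v4, v4', v3, v1, v2} = {v4, v4', v1, v2}"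
    using dist by auto
  \<comment> \<open>The cut puts \<open>v4\<close> together with its neighbours among
    \<open>v1\<close> and \<open>v2\<close>. By hypothesis none of these is linked to
    \<open>v4'\<close>, nor is \<open>v4\<close>, so only \<open>{v1, v2}\<close> can cross
    it.\<close>
  moreover have "\<not> same_block E w {v4, v4', v1, v2} v4 v4'"
  proof (rule not_same_block[where X = "{v4} \<union> {v \<in> {v1, v2}. {v4, v} \<in> E}"])
    fix a b f
    assume ab: "a \<in> {v4} \<union> {v \<in> {v1, v2}. {v4, v} \<in> E}" "b \<notin> {v4} \<union> {v \<in> {v1, v2}. {v4, v} \<in> E}"
      "{a, b} \<in> edges_in E {v4, v4', v1, v2}" and f: "f \<in> edges_in E {v4, v4', v1, v2}"
    have "{a, b} = {v1, v2}"
      using ab v44' v4 edge_in_N unfolding edges_in_def linked_def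
      by (auto simp: insert_commute)
    moreover have "w {v1, v2} \<le> w f"
    proof -
      obtain x y where xy: "f = {x, y}" "x \<noteq> y" "x \<in> {v4, v4', v1, v2}" "y \<in> {v4, v4', v1, v2}"
        "{x, y} \<in> E"
        using f by (rule edges_inE)
      \<comment> \<open>Without both \<open>v4\<close> and \<open>v4'\<close>, the edge
        \<open>f\<close> lies inside one of the two cycles, where \<open>less\<close>
        applies.\<close>
      have "\<not> (v4 \<in> f \<and> v4' \<in> f)"
      proof
        assume "v4 \<in> f \<and> v4' \<in> f"
        then have "f = {v4, v4'}" using v4(1) xy(1) by auto
        then show False using v44' xy by simp
      qed
      then have "f \<subseteq> set C \<or> f \<subseteq> set C'"
        using f set by (auto simp: edges_in_def)
      then show ?thesis
        using less[of f] xy by (cases "f = {v1, v2}") auto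
    qed
    ultimately show "w {a, b} \<le> w f" by simp
  qed (use dist v4 in auto)
  ultimately show False by simp
qed

end

theorem proposition11:
  fixes N :: "'a set" and E :: "'a set set" and w :: "'a set \<Rightarrow> real"
  assumes "simple_graph N E"
    and "\<And>S. S \<noteq> {} \<Longrightarrow> S \<subseteq> N \<Longrightarrow> convex_game N (restricted_game E w (unanimity_game S))"
  shows "reinforced_adjacent_cycles_condition E w"
proof -
  interpret convex_restricted N E w
    using assms by unfold_locales
  show ?thesis
    unfolding reinforced_adjacent_cycles_condition_def
  proof (intro allI impI)
    fix C C'
    assume "is_cycle E C" "is_cycle E C'" "adjacent_cycles C C'"
      and "RAC_case1 E w C C' \<or> RAC_case2a E w C C' \<and> RAC_case2b E w C C'"
    then show "linked E (set C - set C') (set C' - set C)"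
      by (metis RAC_case1_linked RAC_case2_linked)
  qed
qed

end
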